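(* Let $2\le m\le n$ be integers. Then $$\mathrm{QEC}(BK_{n,m})=-\frac{2}{2+\sqrt2}=-(2-\sqrt2)=\mathrm{QEC}(P_4).$$
   Context: For $1\le m\le n$, the bearded complete graph $BK_{n,m}$ is the graph with vertex set $\{1,2,\dots,n\}\cup\{n+1,\dots,n+m\}$ and edge set $\{\{i,j\}:1\le i<j\le n\}\cup\{\{i,n+i\}:1\le i\le m\}$. $P_4$ is the path on $4$ vertices. For a finite connected graph $G=(V,E)$ with $|V|\ge2$, $d(i,j)$ denotes the length of a shortest walk connecting $i$ and $j$ (with $d(i,i)=0$), and $D=[d(i,j)]_{i,j\in V}$ is the distance matrix. $C(V)$ is the space of real-valued functions on $V$, $\langle\cdot,\cdot\rangle$ its canonical inner product, and $\mathbf 1$ the constant function with value $1$. The quadratic embedding constant of $G$ is $$\mathrm{QEC}(G)=\max\{\langle f,Df\rangle : f\in C(V),\ \langle f,f\rangle=1,\ \langle \mathbf 1,f\rangle=0\}.$$ *)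

theory Defs
  imports Complex_Main "HOL-Library.FuncSet" "Graph_Theory.Graph_Theory"
begin

text \<open>
  A finite simple graph is represented by its symmetric digraph (\<^locale>\<open>pair_graph\<close>): each
  undirected edge \<open>{u, v}\<close> becomes the two arcs \<open>(u, v)\<close> and \<open>(v, u)\<close>.
\<close>

definition graph_of :: "'a set \<Rightarrow> 'a set set \<Rightarrow> 'a pair_pre_digraph" where
  "graph_of V E = \<lparr> pverts = V, parcs = {(u, v). {u, v} \<in> E} \<rparr>"

definition bearded_complete_graph :: "nat \<Rightarrow> nat \<Rightarrow> nat pair_pre_digraph" where
  "bearded_complete_graph n m =
     graph_of ({1..n} \<union> {n + 1..n + m})
       ({{i, j} | i j. 1 \<le> i \<and> i < j \<and> j \<le> n} \<union> {{i, n + i} | i. 1 \<le> i \<and> i \<le> m})"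

definition path_graph :: "nat \<Rightarrow> nat pair_pre_digraph" where
  "path_graph n = graph_of {1..n} {{i, i + 1} | i. 1 \<le> i \<and> i < n}"

text \<open>
  The value is unspecified if no walk leads from \<open>u\<close> to \<open>v\<close>; only connected graphs are of
  interest here.
\<close>

definition graph_dist :: "'a pair_pre_digraph \<Rightarrow> 'a \<Rightarrow> 'a \<Rightarrow> nat" where
  "graph_dist G u v =
     (LEAST l. \<exists>p. pre_digraph.awalk (with_proj G) u p v \<and> length p = l)"

text \<open>The space \<open>C(V)\<close> is \<^term>\<open>extensional V :: ('a \<Rightarrow> real) set\<close>.\<close>

definition inner_on :: "'a set \<Rightarrow> ('a \<Rightarrow> real) \<Rightarrow> ('a \<Rightarrow> real) \<Rightarrow> real" where
  "inner_on V f g = (\<Sum>v\<in>V. f v * g v)"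

definition dist_matrix_apply :: "'a pair_pre_digraph \<Rightarrow> ('a \<Rightarrow> real) \<Rightarrow> 'a \<Rightarrow> real" where
  "dist_matrix_apply G f = (\<lambda>i\<in>pverts G. \<Sum>j\<in>pverts G. real (graph_dist G i j) * f j)"

text \<open>
  \<^const>\<open>Greatest\<close> (and not \<^const>\<open>Sup\<close>) is used so that the constant is a maximum, attained
  by some \<open>f\<close>; \<^const>\<open>Max\<close> is not applicable as the set of values is infinite in general.
\<close>

definition QEC :: "'a pair_pre_digraph \<Rightarrow> real" where
  "QEC G = (GREATEST q. q \<in>
     {inner_on (pverts G) f (dist_matrix_apply G f) | f.
        f \<in> extensional (pverts G) \<and>
        inner_on (pverts G) f f = 1 \<and> inner_on (pverts G) (\<lambda>v\<in>pverts G. 1) f = 0})"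

lemma pair_graph_graph_of:
  assumes "finite V" and "\<And>e. e \<in> E \<Longrightarrow> e \<subseteq> V \<and> card e = 2"
  shows "pair_graph (graph_of V E)"
proof -
  have "{(u, v). {u, v} \<in> E} \<subseteq> V \<times> V"
    using assms(2) by blast
  then have fin: "finite {(u, v). {u, v} \<in> E}"
    using assms(1) finite_subset by blast
  show ?thesis
  proof
    fix e assume "e \<in> parcs (graph_of V E)"
    then show "fst e \<in> pverts (graph_of V E)" and "snd e \<in> pverts (graph_of V E)"
      and "fst e \<noteq> snd e"
      using assms(2)[of "{fst e, snd e}"] by (auto simp: graph_of_def)
  next
    show "finite (pverts (graph_of V E))" and "finite (parcs (graph_of V E))"
      using assms(1) fin by (simp_all add: graph_of_def)
  next
    show "symmetric (with_proj (graph_of V E))"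
      by (auto simp: symmetric_def sym_def arcs_ends_def arc_to_ends_def graph_of_def
          insert_commute)
  qed
qed

lemma pair_graph_bearded_complete_graph:
  assumes "m \<le> n"
  shows "pair_graph (bearded_complete_graph n m)"
  unfolding bearded_complete_graph_def
  by (rule pair_graph_graph_of) (use assms in auto)

lemma pair_graph_path_graph: "pair_graph (path_graph n)"
  unfolding path_graph_def by (rule pair_graph_graph_of) auto

end

theory Submission
  imports Defs
begin

text \<open>
  The theorem holds because both graphs are cliques in which each vertex carries at most one
  pendant vertex (a tip), with at least two tips in total; the path on 4 vertices is the case of a
  2-clique with both tips present. For such a graph, write a shortest walk between distinct vertices
  as a descent to the clique, at most one clique edge, and an ascent. The distance is then the sum of
  two heights, plus 1 if the vertices hang on different clique vertices. On functions \<open>f\<close> with sum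
  0 the heights and the constant 1 drop out, up to a diagonal correction, and the distance form
  becomes
  \<open>- (\<Sum>c. (x\<^sub>c + y\<^sub>c)\<^sup>2 + 2 * y\<^sub>c\<^sup>2)\<close>,
  where \<open>c\<close> runs over the clique, \<open>x\<^sub>c\<close> is the value of \<open>f\<close> at \<open>c\<close>, and \<open>y\<^sub>c\<close> is its value at
  the tip of \<open>c\<close>, or 0 if there is none (lemma \<open>dist_form_eq\<close>).

  This is an orthogonal sum of forms in at most two variables. The two-variable form has smallest
  eigenvalue \<open>2 - sqrt 2\<close> (lemma \<open>pair_form_lower_bound\<close>) and the one-variable form has
  eigenvalue 1, which is larger; so \<open>- (2 - sqrt 2)\<close> is an upper bound on unit vectors. Placing
  opposite eigenvectors at two clique vertices with tips gives sum 0 and attains the bound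
  (lemma \<open>dist_form_maximizer\<close>).
\<close>

section \<open>Certifying graph distances\<close>

text \<open>
  A function \<open>g\<close> that vanishes at the target, drops by at most 1 along each arc and can be made to
  drop by exactly 1 away from the target is the distance to the target: the second property bounds
  the length of every walk from below, and following the descents gives a walk of length \<open>g u\<close>.
\<close>

lemma graph_dist_eqI:
  fixes g :: "'a \<Rightarrow> nat"
  assumes verts: "\<And>a b. (a, b) \<in> parcs G \<Longrightarrow> b \<in> pverts G"
    and target: "g v = 0"
    and step: "\<And>a b. (a, b) \<in> parcs G \<Longrightarrow> g a \<le> g b + 1"
    and descent: "\<And>a. a \<in> pverts G \<Longrightarrow> a \<noteq> v \<Longrightarrow> \<exists>b. (a, b) \<in> parcs G \<and> g a = g b + 1"
    and u: "u \<in> pverts G"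
  shows "graph_dist G u v = g u"
proof -
  let ?G = "with_proj G"
  have lower: "g a \<le> length p" if "set p \<subseteq> parcs G" "pre_digraph.cas ?G a p v" for a p
    using that
  proof (induction p arbitrary: a)
    case Nil
    then show ?case using target by (simp add: pre_digraph.cas.simps)
  next
    case (Cons e p)
    have e: "a = fst e" "set p \<subseteq> parcs G" "e \<in> parcs G"
      and p: "pre_digraph.cas ?G (snd e) p v"
      using Cons.prems by (simp_all add: pre_digraph.cas.simps)
    have "g a \<le> g (snd e) + 1" using e by (intro step) simp
    also have "g (snd e) \<le> length p" using e(2) p by (rule Cons.IH)
    finally show ?case by simp
  qed
  have upper: "\<exists>p. pre_digraph.awalk ?G a p v \<and> length p = g a"
    if "a \<in> pverts G" for a
    using that
  proof (induction "g a" arbitrary: a rule: less_induct)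
    case less
    show ?case
    proof (cases "a = v")
      case True
      then show ?thesis using less.prems target
        by (auto simp: pre_digraph.awalk_def pre_digraph.cas.simps)
    next
      case False
      then obtain b where b: "(a, b) \<in> parcs G" "g a = g b + 1"
        using descent less.prems by blast
      then obtain p where "pre_digraph.awalk ?G b p v" "length p = g b"
        using less.hyps[of b] verts by auto
      then have "pre_digraph.awalk ?G a ((a, b) # p) v \<and> length ((a, b) # p) = g a"
        using b less.prems by (simp add: pre_digraph.awalk_def pre_digraph.cas.simps)
      then show ?thesis by blast
    qed
  qed
  show ?thesis
    unfolding graph_dist_def
    by (rule Least_equality)
      (use upper[OF u] lower in \<open>auto simp: pre_digraph.awalk_def\<close>)
qed

section \<open>The two-point quadratic form\<close>

text \<open>
  On a fibre \<open>{c, t}\<close> with \<open>x = f c\<close> and \<open>y = f t\<close> the negated distance form is the right-hand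
  side, whose matrix has rows \<open>1, 1\<close> and \<open>1, 3\<close>. Its eigenvalues are the roots \<open>2 - sqrt 2\<close> and
  \<open>2 + sqrt 2\<close> of \<open>\<lambda>\<^sup>2 - 4 * \<lambda> + 2\<close>, so the matrix of the difference of the two sides is
  positive semidefinite and singular, and the difference is a nonnegative multiple of a square.
\<close>

lemma pair_form_lower_bound:
  fixes x y :: real
  shows "(2 - sqrt 2) * (x\<^sup>2 + y\<^sup>2) \<le> (x + y)\<^sup>2 + 2 * y\<^sup>2"
proof -
  have "(r - 1) * (x + (1 + r) * y)\<^sup>2 = (x + y)\<^sup>2 + 2 * y\<^sup>2 - (2 - r) * (x\<^sup>2 + y\<^sup>2)
      + (r\<^sup>2 - 2) * (2 * x * y + (r + 1) * y\<^sup>2)" for r :: real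
    by (simp add: power2_eq_square algebra_simps)
  from this[of "sqrt 2"]
  have "(x + y)\<^sup>2 + 2 * y\<^sup>2 - (2 - sqrt 2) * (x\<^sup>2 + y\<^sup>2) =
      (sqrt 2 - 1) * (x + (1 + sqrt 2) * y)\<^sup>2"
    by simp
  moreover have "0 \<le> (sqrt 2 - 1) * (x + (1 + sqrt 2) * y)\<^sup>2"
    by simp
  ultimately show ?thesis by linarith
qed

section \<open>Cliques with pendant vertices\<close>

text \<open>
  A clique \<open>B\<close> in which each vertex carries at most one further vertex, a tip; \<open>base\<close> sends a
  tip to its neighbour in \<open>B\<close> and fixes \<open>B\<close>. Describing the graph by this retraction treats
  clique vertices and tips alike: two distinct vertices are adjacent iff both lie in \<open>B\<close>
  or both have the same base.
\<close>

locale bearded_clique =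
  fixes G :: "'a pair_pre_digraph" and B :: "'a set" and base :: "'a \<Rightarrow> 'a"
  assumes finite_verts: "finite (pverts G)"
    and clique_subset: "B \<subseteq> pverts G"
    and base_in: "v \<in> pverts G \<Longrightarrow> base v \<in> B"
    and base_id: "c \<in> B \<Longrightarrow> base c = c"
    and base_inj: "inj_on base (pverts G - B)"
    and arcs_iff: "(u, v) \<in> parcs G \<longleftrightarrow> u \<in> pverts G \<and> v \<in> pverts G \<and> u \<noteq> v \<and>
          (u \<in> B \<and> v \<in> B \<or> base u = base v)"
begin

abbreviation V :: "'a set" where "V \<equiv> pverts G"

text \<open>The distance from \<open>v\<close> to the clique.\<close>

abbreviation height :: "'a \<Rightarrow> nat" where "height v \<equiv> of_bool (v \<notin> B)"

abbreviation fibre :: "'a \<Rightarrow> 'a set" where "fibre c \<equiv> {v \<in> V. base v = c}"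

lemma finite_clique: "finite B"
  using finite_verts clique_subset finite_subset by blast

lemma fibre_tip:
  assumes "t \<in> V - B"
  shows "fibre (base t) = {base t, t}"
  using assms base_in[of t] base_id clique_subset base_inj
  by (auto dest: inj_onD)

lemma fibre_cases:
  assumes "c \<in> B"
  obtains "fibre c = {c}" | t where "t \<in> V - B" "fibre c = {c, t}" "base t = c"
proof (cases "\<exists>t\<in>V - B. base t = c")
  case True
  then show thesis using that(2) fibre_tip by blast
next
  case False
  then have "fibre c = {c}" using assms base_id clique_subset by auto
  then show thesis by (rule that(1))
qed

text \<open>
  A shortest walk between distinct vertices descends from each end to its base and crosses the
  clique by at most one edge.
\<close>

lemma graph_dist_eq:
  assumes "u \<in> V" "v \<in> V"
  shows "graph_dist G u v =
    (if u = v then 0 else height u + height v + of_bool (base u \<noteq> base v))"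
proof (rule graph_dist_eqI[where g = "\<lambda>u. if u = v then 0
    else height u + height v + of_bool (base u \<noteq> base v)"])
  fix a b assume ab: "(a, b) \<in> parcs G"
  then show "b \<in> V" by (simp add: arcs_iff)
  have "a \<in> B \<or> b \<in> B"
    using ab base_inj by (auto simp: arcs_iff dest: inj_onD)
  then show "(if a = v then 0 else height a + height v + of_bool (base a \<noteq> base v))
    \<le> (if b = v then 0 else height b + height v + of_bool (base b \<noteq> base v)) + 1"
    using ab by (auto simp: arcs_iff base_id)
next
  fix a assume a: "a \<in> V" "a \<noteq> v"
  define b where "b = (if a \<notin> B then base a else if base v = a then v else base v)"
  have "(a, b) \<in> parcs G"
    using a assms base_in[of a] base_in[of v]
    by (auto simp: b_def arcs_iff base_id dest: subsetD[OF clique_subset])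
  moreover have "(if a = v then 0 else height a + height v + of_bool (base a \<noteq> base v))
    = (if b = v then 0 else height b + height v + of_bool (base b \<noteq> base v)) + 1"
    using a assms base_in[of a] base_in[of v] base_id by (auto simp: b_def)
  ultimately show "\<exists>b. (a, b) \<in> parcs G \<and>
      (if a = v then 0 else height a + height v + of_bool (base a \<noteq> base v))
    = (if b = v then 0 else height b + height v + of_bool (base b \<noteq> base v)) + 1"
    by blast
qed (use assms in auto)

text \<open>
  The entry of the distance matrix at \<open>u, v\<close> is \<open>height u + height v + 1\<close>, minus 1 if the bases
  agree, minus \<open>2 * height u\<close> on the diagonal (where the general formula would give
  \<open>2 * height u\<close> instead of 0). For \<open>f\<close> with sum 0, the summands that depend on
  at most one of \<open>u\<close> and \<open>v\<close> cancel, and the remaining two corrections decompose over the fibres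
  of \<open>base\<close>.
\<close>

lemma dist_form_eq:
  fixes f :: "'a \<Rightarrow> real"
  assumes sum0: "sum f V = 0"
  shows "inner_on V f (dist_matrix_apply G f) =
    - (\<Sum>c\<in>B. (sum f (fibre c))\<^sup>2 + 2 * (\<Sum>v\<in>fibre c. real (height v) * (f v)\<^sup>2))"
proof -
  let ?h = "\<lambda>v. real (height v)"
  have dist: "real (graph_dist G u v) * f v =
      ?h u * f v + ?h v * f v + f v - (if base v = base u then f v else 0)
      - (if v = u then 2 * ?h u * f v else 0)"
    if "u \<in> V" "v \<in> V" for u v
    using that by (auto simp: graph_dist_eq algebra_simps)
  have row: "dist_matrix_apply G f u =
      (\<Sum>v\<in>V. ?h v * f v) - sum f (fibre (base u)) - 2 * ?h u * f u"
    if u: "u \<in> V" for u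
  proof -
    have "dist_matrix_apply G f u = (\<Sum>v\<in>V. ?h u * f v + ?h v * f v + f v
      - (if base v = base u then f v else 0) - (if v = u then 2 * ?h u * f v else 0))"
      using u by (simp add: dist_matrix_apply_def dist cong: sum.cong)
    also have "\<dots> = ?h u * sum f V + (\<Sum>v\<in>V. ?h v * f v) + sum f V
      - (\<Sum>v\<in>V. if base v = base u then f v else 0)
      - (\<Sum>v\<in>V. if v = u then 2 * ?h u * f v else 0)"
      by (simp only: sum.distrib sum_subtractf sum_distrib_left)
    also have "(\<Sum>v\<in>V. if base v = base u then f v else 0) = sum f (fibre (base u))"
      by (rule sum.inter_filter[symmetric]) (rule finite_verts)
    also have "(\<Sum>v\<in>V. if v = u then 2 * ?h u * f v else 0) = 2 * ?h u * f u"
      using u finite_verts by simp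
    finally show ?thesis by (simp add: sum0)
  qed
  have "inner_on V f (dist_matrix_apply G f) = (\<Sum>u\<in>V. f u * (\<Sum>v\<in>V. ?h v * f v)
      - (f u * sum f (fibre (base u)) + 2 * (?h u * (f u)\<^sup>2)))"
    unfolding inner_on_def
    by (rule sum.cong) (simp_all add: row algebra_simps power2_eq_square)
  also have "\<dots> = - (\<Sum>u\<in>V. f u * sum f (fibre (base u)) + 2 * (?h u * (f u)\<^sup>2))"
    by (simp add: sum_subtractf sum_distrib_right[symmetric] sum0)
  also have "(\<Sum>u\<in>V. f u * sum f (fibre (base u)) + 2 * (?h u * (f u)\<^sup>2)) =
      (\<Sum>c\<in>B. \<Sum>u\<in>fibre c. f u * sum f (fibre (base u)) + 2 * (?h u * (f u)\<^sup>2))"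
    using finite_verts finite_clique base_in by (intro sum.group[symmetric]) auto
  also have "\<dots> = (\<Sum>c\<in>B. (sum f (fibre c))\<^sup>2 + 2 * (\<Sum>v\<in>fibre c. ?h v * (f v)\<^sup>2))"
  proof (rule sum.cong[OF refl])
    fix c assume "c \<in> B"
    have "(\<Sum>u\<in>fibre c. f u * sum f (fibre (base u)) + 2 * (?h u * (f u)\<^sup>2)) =
        (\<Sum>u\<in>fibre c. f u * sum f (fibre c) + 2 * (?h u * (f u)\<^sup>2))"
      by (rule sum.cong) auto
    also have "\<dots> = sum f (fibre c) * sum f (fibre c) + 2 * (\<Sum>v\<in>fibre c. ?h v * (f v)\<^sup>2)"
      by (simp only: sum.distrib sum_distrib_right[symmetric] sum_distrib_left[symmetric])
    finally show "(\<Sum>u\<in>fibre c. f u * sum f (fibre (base u)) + 2 * (?h u * (f u)\<^sup>2)) =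
        (sum f (fibre c))\<^sup>2 + 2 * (\<Sum>v\<in>fibre c. ?h v * (f v)\<^sup>2)"
      by (simp add: power2_eq_square)
  qed
  finally show ?thesis .
qed

lemma norm_by_fibres:
  fixes f :: "'a \<Rightarrow> real"
  shows "inner_on V f f = (\<Sum>c\<in>B. \<Sum>v\<in>fibre c. (f v)\<^sup>2)"
proof -
  have "(\<Sum>c\<in>B. \<Sum>v\<in>fibre c. (f v)\<^sup>2) = (\<Sum>v\<in>V. (f v)\<^sup>2)"
    using finite_verts finite_clique base_in by (intro sum.group) auto
  then show ?thesis by (simp add: inner_on_def power2_eq_square)
qed

text \<open>
  The bound holds fibre by fibre: for \<open>{c, t}\<close> it is the eigenvalue estimate above, and for a
  clique vertex without a tip it holds because \<open>2 - sqrt 2 \<le> 1\<close>.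
\<close>

lemma dist_form_upper_bound:
  fixes f :: "'a \<Rightarrow> real"
  assumes "sum f V = 0"
  shows "inner_on V f (dist_matrix_apply G f) \<le> - (2 - sqrt 2) * inner_on V f f"
proof -
  have "(2 - sqrt 2) * (\<Sum>v\<in>fibre c. (f v)\<^sup>2) \<le>
      (sum f (fibre c))\<^sup>2 + 2 * (\<Sum>v\<in>fibre c. real (height v) * (f v)\<^sup>2)"
    if c: "c \<in> B" for c
    using c
  proof (cases rule: fibre_cases)
    case 1
    have "(2 - sqrt 2) * (f c)\<^sup>2 \<le> 1 * (f c)\<^sup>2"
      by (intro mult_right_mono) auto
    with 1 c show ?thesis by simp
  next
    case (2 t)
    then have "c \<noteq> t" using c by auto
    with 2 c show ?thesis using pair_form_lower_bound[of "f c" "f t"] by simp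
  qed
  then have "(\<Sum>c\<in>B. (2 - sqrt 2) * (\<Sum>v\<in>fibre c. (f v)\<^sup>2)) \<le>
      (\<Sum>c\<in>B. (sum f (fibre c))\<^sup>2 + 2 * (\<Sum>v\<in>fibre c. real (height v) * (f v)\<^sup>2))"
    by (rule sum_mono)
  then show ?thesis
    unfolding dist_form_eq[OF assms] norm_by_fibres sum_distrib_left[symmetric]
    by linarith
qed

text \<open>
  A vector in the eigenspace of \<open>2 - sqrt 2\<close> on one fibre with a tip, its negative on another and 0
  elsewhere has sum 0 and turns the fibrewise estimate into an equality. This is where two tips
  are needed: the entries of the eigenvector do not add up to 0 on a single fibre.
\<close>

lemma dist_form_maximizer:
  assumes p: "p \<in> V - B" and q: "q \<in> V - B" and "p \<noteq> q"
  obtains f :: "'a \<Rightarrow> real" where "f \<in> extensional V" "inner_on V f f = 1" "sum f V = 0"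
    "inner_on V f (dist_matrix_apply G f) = - (2 - sqrt 2)"
proof -
  have neq: "base p \<noteq> base q" using assms base_inj by (auto dest: inj_onD)
  have bases: "base p \<in> B" "base q \<in> B" using p q base_in by auto
  \<comment> \<open>The eigenvector is proportional to \<open>(1, 1 - sqrt 2)\<close>; two copies of it have squared norm
    \<open>2 * (1 + (1 - sqrt 2)\<^sup>2) = 8 - 4 * sqrt 2\<close>.\<close>
  define k :: real where "k = 1 / sqrt (8 - 4 * sqrt 2)"
  have pos: "0 < 8 - 4 * sqrt (2::real)"
  proof -
    have "sqrt (2::real) < sqrt 4" by (rule real_sqrt_less_mono) simp
    then show ?thesis by simp
  qed
  then have k: "k\<^sup>2 * (8 - 4 * sqrt 2) = 1"
    by (simp add: k_def power_divide)
  define \<sigma> :: "'a \<Rightarrow> real" where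
    "\<sigma> c = (if c = base p then k else if c = base q then - k else 0)" for c
  define f where
    "f = (\<lambda>v\<in>V. \<sigma> (base v) * (if v \<in> B then 1 else 1 - sqrt 2))"
  have f: "f v = \<sigma> (base v) * (if v \<in> B then 1 else 1 - sqrt 2)" if "v \<in> V" for v
    using that by (simp add: f_def)
  have other: "f v = 0" if "v \<in> fibre c" "c \<noteq> base p" "c \<noteq> base q" for v c
    using that by (auto simp: f \<sigma>_def)
  have fib: "f (base p) = k" "f p = k * (1 - sqrt 2)"
    "f (base q) = - k" "f q = - k * (1 - sqrt 2)"
    using p q bases neq base_id clique_subset by (auto simp: f \<sigma>_def subset_iff)
  have ne: "base p \<noteq> p" "base q \<noteq> q" using p q bases by auto
  have two: "sum F B = F (base p) + F (base q)"
    if "\<And>c. c \<noteq> base p \<Longrightarrow> c \<noteq> base q \<Longrightarrow> F c = 0" for F :: "'a \<Rightarrow> real"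
  proof -
    have "sum F B = sum F {base p, base q}"
      by (rule sum.mono_neutral_right) (use finite_clique bases that in auto)
    then show ?thesis using neq by simp
  qed
  have "sum f V = (\<Sum>c\<in>B. sum f (fibre c))"
    using finite_verts finite_clique base_in by (intro sum.group[symmetric]) auto
  also have "\<dots> = sum f (fibre (base p)) + sum f (fibre (base q))"
    by (rule two) (use other in \<open>auto intro!: sum.neutral\<close>)
  also have "\<dots> = 0"
    unfolding fibre_tip[OF p] fibre_tip[OF q] using ne by (simp add: fib)
  finally have zero: "sum f V = 0" .
  have "inner_on V f f =
      (\<Sum>v\<in>fibre (base p). (f v)\<^sup>2) + (\<Sum>v\<in>fibre (base q). (f v)\<^sup>2)"
    unfolding norm_by_fibres by (rule two) (use other in \<open>auto intro!: sum.neutral\<close>)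
  also have "\<dots> = 1"
    unfolding fibre_tip[OF p] fibre_tip[OF q] using ne
    by (simp add: fib) (use k in \<open>simp add: power2_eq_square algebra_simps\<close>)
  finally have one: "inner_on V f f = 1" .
  have "(2 - sqrt 2) * (k\<^sup>2 * (8 - 4 * sqrt 2)) = k\<^sup>2 * (24 - 16 * sqrt 2)"
    by (simp add: algebra_simps)
  with k have form_value: "k\<^sup>2 * (24 - 16 * sqrt 2) = 2 - sqrt 2" by simp
  have "(\<Sum>c\<in>B. (sum f (fibre c))\<^sup>2 + 2 * (\<Sum>v\<in>fibre c. real (height v) * (f v)\<^sup>2)) =
      ((sum f (fibre (base p)))\<^sup>2 + 2 * (\<Sum>v\<in>fibre (base p). real (height v) * (f v)\<^sup>2)) +
      ((sum f (fibre (base q)))\<^sup>2 + 2 * (\<Sum>v\<in>fibre (base q). real (height v) * (f v)\<^sup>2))"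
    by (rule two) (use other in \<open>auto intro!: sum.neutral\<close>)
  also have "\<dots> = 2 - sqrt 2"
    unfolding fibre_tip[OF p] fibre_tip[OF q] using ne p q bases form_value
    by (simp add: fib) (simp add: power2_eq_square algebra_simps)
  finally have "inner_on V f (dist_matrix_apply G f) = - (2 - sqrt 2)"
    by (simp add: dist_form_eq[OF zero])
  moreover have "f \<in> extensional V" by (simp add: f_def)
  ultimately show thesis using that zero one by blast
qed

theorem QEC_eq:
  assumes "p \<in> V - B" "q \<in> V - B" "p \<noteq> q"
  shows "QEC G = - (2 - sqrt 2)"
proof -
  have ones: "inner_on V (\<lambda>v\<in>V. 1) f = sum f V" for f :: "'a \<Rightarrow> real"
    by (simp add: inner_on_def)
  obtain f :: "'a \<Rightarrow> real" where "f \<in> extensional V" "inner_on V f f = 1" "sum f V = 0"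
    "inner_on V f (dist_matrix_apply G f) = - (2 - sqrt 2)"
    using dist_form_maximizer[OF assms] .
  then show ?thesis
    unfolding QEC_def ones
    by (intro Greatest_equality) (force, use dist_form_upper_bound in force)
qed

end

section \<open>Bearded complete graphs and the path on four vertices\<close>

lemma bearded_clique_bearded_complete_graph:
  assumes "m \<le> n"
  shows "bearded_clique (bearded_complete_graph n m) {1..n} (\<lambda>v. if v \<le> n then v else v - n)"
proof
  have V: "pverts (bearded_complete_graph n m) = {1..n + m}"
    using assms by (auto simp: bearded_complete_graph_def graph_of_def)
  show "inj_on (\<lambda>v. if v \<le> n then v else v - n) (pverts (bearded_complete_graph n m) - {1..n})"
    unfolding V by (auto simp: inj_on_def)
  fix u v
  have "(u, v) \<in> parcs (bearded_complete_graph n m) \<longleftrightarrow>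
      1 \<le> u \<and> u < v \<and> v \<le> n \<or> 1 \<le> v \<and> v < u \<and> u \<le> n \<or>
      1 \<le> u \<and> u \<le> m \<and> v = n + u \<or> 1 \<le> v \<and> v \<le> m \<and> u = n + v"
    by (auto simp: bearded_complete_graph_def graph_of_def doubleton_eq_iff)
  also have "\<dots> \<longleftrightarrow> u \<in> {1..n + m} \<and> v \<in> {1..n + m} \<and> u \<noteq> v \<and>
      (u \<in> {1..n} \<and> v \<in> {1..n} \<or>
        (if u \<le> n then u else u - n) = (if v \<le> n then v else v - n))"
    using assms by auto
  finally show "(u, v) \<in> parcs (bearded_complete_graph n m) \<longleftrightarrow>
      u \<in> pverts (bearded_complete_graph n m) \<and> v \<in> pverts (bearded_complete_graph n m) \<and>
      u \<noteq> v \<and> (u \<in> {1..n} \<and> v \<in> {1..n} \<or>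
        (if u \<le> n then u else u - n) = (if v \<le> n then v else v - n))"
    unfolding V .
qed (use assms in \<open>auto simp: bearded_complete_graph_def graph_of_def\<close>)

lemma bearded_clique_path_graph_4:
  "bearded_clique (path_graph 4) {2, 3} (\<lambda>v. if v \<le> 2 then 2 else 3)"
proof
  have V: "pverts (path_graph 4) = {1, 2, 3, 4}"
    by (auto simp: path_graph_def graph_of_def)
  then show "inj_on (\<lambda>v. if v \<le> 2 then 2 else 3 :: nat) (pverts (path_graph 4) - {2, 3})"
    by (auto simp: inj_on_def)
  fix u v
  have "(u, v) \<in> parcs (path_graph 4) \<longleftrightarrow>
      u \<in> {1, 2, 3, 4} \<and> v \<in> {1, 2, 3, 4} \<and> (v = u + 1 \<or> u = v + 1)"
    by (auto simp: path_graph_def graph_of_def doubleton_eq_iff)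
  then show "(u, v) \<in> parcs (path_graph 4) \<longleftrightarrow>
      u \<in> pverts (path_graph 4) \<and> v \<in> pverts (path_graph 4) \<and> u \<noteq> v \<and>
      (u \<in> {2, 3} \<and> v \<in> {2, 3} \<or>
        (if u \<le> 2 then 2 else 3 :: nat) = (if v \<le> 2 then 2 else 3))"
    unfolding V by auto
qed (auto simp: path_graph_def graph_of_def)

theorem theorem4p16:
  fixes n m :: nat
  assumes "2 \<le> m" and "m \<le> n"
  shows "QEC (bearded_complete_graph n m) = - (2 / (2 + sqrt 2)) \<and>
         - (2 / (2 + sqrt 2)) = - (2 - sqrt 2) \<and>
         - (2 - sqrt 2) = QEC (path_graph 4)"
proof -
  have "QEC (bearded_complete_graph n m) = - (2 - sqrt 2)"
    by (rule bearded_clique.QEC_eq[OF bearded_clique_bearded_complete_graph,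
          where p = "n + 1" and q = "n + 2"])
      (use assms in \<open>auto simp: bearded_complete_graph_def graph_of_def\<close>)
  moreover have "QEC (path_graph 4) = - (2 - sqrt 2)"
    by (rule bearded_clique.QEC_eq[OF bearded_clique_path_graph_4, where p = 1 and q = 4])
      (auto simp: path_graph_def graph_of_def)
  moreover have "2 / (2 + sqrt 2) = 2 - sqrt (2::real)"
  proof -
    have "2 + sqrt (2::real) \<noteq> 0"
      by (metis add_pos_pos less_irrefl real_sqrt_gt_zero zero_less_numeral)
    then show ?thesis by (simp add: field_simps)
  qed
  ultimately show ?thesis by simp
qed

end
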